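(* Let $G_1,G_2$ be finite simple connected graphs, $G_i$ having $n_i$ vertices and $m_i$ edges. Then the corona product $G_1\odot G_2$ satisfies \[F(G_1\odot G_2)=F(G_1)+n_1F(G_2)+3n_2M_1(G_1)+3n_1M_1(G_2)+6n_2^2m_1+6n_1m_2+n_1n_2(n_2^2+1).\]
   Context: The corona product $G_1\odot G_2$ is obtained by taking one copy of $G_1$ (with vertices $v_1,\ldots,v_{n_1}$) and $n_1$ vertex-disjoint copies of $G_2$, and joining each vertex of the $i$-th copy of $G_2$ to the vertex $v_i$ of $G_1$, for $1\le i\le n_1$. For a finite simple graph $G$ with vertex degrees $d_G(v)$: $M_1(G)=\sum_{v} d_G(v)^2$ and $F(G)=\sum_{v} d_G(v)^3$. *)

theory Defs
  imports "Graph_Theory.Graph_Theory"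
begin

text \<open>
  A finite simple graph is a \<^locale>\<open>pair_graph\<close>: a finite, loop-free, symmetric set of pairs
  on a finite vertex set. Each undirected edge is represented by two arcs, so edges are counted
  as two-element sets of endpoints.
\<close>

definition edges :: "'a pair_pre_digraph \<Rightarrow> 'a set set" where
  "edges G = {{u, v} | u v. (u, v) \<in> parcs G}"

definition vertex_degree :: "'a pair_pre_digraph \<Rightarrow> 'a \<Rightarrow> nat" where
  "vertex_degree G v = card {e \<in> edges G. v \<in> e}"

definition M1_index :: "'a pair_pre_digraph \<Rightarrow> nat" where
  "M1_index G = (\<Sum>v\<in>pverts G. (vertex_degree G v)\<^sup>2)"

definition F_index :: "'a pair_pre_digraph \<Rightarrow> nat" where
  "F_index G = (\<Sum>v\<in>pverts G. vertex_degree G v ^ 3)"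

text \<open>
  \<open>Inl v\<close> is the vertex \<open>v\<close> of \<open>G1\<close>, and \<open>Inr (v, x)\<close> is the vertex \<open>x\<close> in the copy of \<open>G2\<close>
  attached to \<open>v\<close>.
\<close>

definition corona ::
  "'a pair_pre_digraph \<Rightarrow> 'b pair_pre_digraph \<Rightarrow> ('a + 'a \<times> 'b) pair_pre_digraph" where
  "corona G1 G2 =
    \<lparr> pverts = Inl ` pverts G1 \<union> Inr ` (pverts G1 \<times> pverts G2),
      parcs =
        {(Inl u, Inl v) | u v. (u, v) \<in> parcs G1}
        \<union> {(Inr (v, x), Inr (v, y)) | v x y. v \<in> pverts G1 \<and> (x, y) \<in> parcs G2}
        \<union> {(Inl v, Inr (v, x)) | v x. v \<in> pverts G1 \<and> x \<in> pverts G2}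
        \<union> {(Inr (v, x), Inl v) | v x. v \<in> pverts G1 \<and> x \<in> pverts G2} \<rparr>"

lemma pair_graph_corona:
  assumes "pair_graph G1" "pair_graph G2"
  shows "pair_graph (corona G1 G2)"
proof -
  interpret G1: pair_graph G1 by fact
  interpret G2: pair_graph G2 by fact
  let ?C = "corona G1 G2"
  have sub: "parcs ?C \<subseteq> pverts ?C \<times> pverts ?C"
    by (auto simp: corona_def dest: G1.wellformed' G2.wellformed')
  have fin: "finite (pverts ?C)"
    by (simp add: corona_def)
  have irr: "u \<noteq> v" if "(u, v) \<in> parcs ?C" for u v
    using that by (auto simp: corona_def dest: G1.pair_no_loops G2.pair_no_loops)
  have sym: "sym (parcs ?C)"
    using G1.pair_sym_arcs G2.pair_sym_arcs by (auto simp: corona_def symmetric_def sym_def)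
  show ?thesis
  proof
    show "finite (parcs ?C)"
      using finite_subset[OF sub] fin by blast
    show "symmetric (with_proj ?C)"
      using sym by (simp add: symmetric_def)
  qed (use sub fin irr in auto)
qed

end

theory Submission
  imports Defs
begin

text \<open>
  In the corona, a vertex of \<open>G1\<close> gains \<open>n2\<close> neighbours and a vertex of a copy of \<open>G2\<close> gains one.
  Expanding the cubes \<open>(d + n2) ^ 3\<close> and \<open>(d + 1) ^ 3\<close> and using the handshake lemma for the
  linear terms gives the formula.
\<close>

context pair_graph
begin

lemma finite_edges: "finite (edges G)"
proof -
  have "edges G = (\<lambda>(u, v). {u, v}) ` parcs G"
    by (auto simp: edges_def)
  then show ?thesis
    by simp
qed

lemma vertex_degree_eq_card_neighbours:
  "vertex_degree G v = card {w. (v, w) \<in> parcs G}"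
proof -
  have sym: "(b, a) \<in> parcs G" if "(a, b) \<in> parcs G" for a b
    using that pair_sym_arcs by (auto simp: symmetric_def sym_def)
  have "{e \<in> edges G. v \<in> e} = (\<lambda>w. {v, w}) ` {w. (v, w) \<in> parcs G}"
    by (auto simp: edges_def insert_commute dest: sym)
  moreover have "inj_on (\<lambda>w. {v, w}) {w. (v, w) \<in> parcs G}"
    by (auto simp: inj_on_def doubleton_eq_iff)
  ultimately show ?thesis
    by (simp add: vertex_degree_def card_image)
qed

lemma sum_vertex_degree: "(\<Sum>v\<in>pverts G. vertex_degree G v) = 2 * card (edges G)"
proof -
  have "card {v \<in> pverts G. v \<in> e} = 2" if "e \<in> edges G" for e
  proof -
    obtain a b where e: "e = {a, b}" and ab: "(a, b) \<in> parcs G"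
      using \<open>e \<in> edges G\<close> by (auto simp: edges_def)
    have "{v \<in> pverts G. v \<in> e} = {a, b}"
      using e wellformed'[OF ab] by auto
    then show ?thesis
      using pair_no_loops[OF ab] by simp
  qed
  then show ?thesis
    unfolding vertex_degree_def
    by (intro sum_multicount) (auto simp: finite_edges)
qed

lemma sum_vertex_degree_plus_cubed:
  "(\<Sum>v\<in>pverts G. (vertex_degree G v + k) ^ 3) =
    F_index G + 3 * k * M1_index G + 6 * k\<^sup>2 * card (edges G) + card (pverts G) * k ^ 3"
proof -
  have "(d + k) ^ 3 = d ^ 3 + 3 * k * d\<^sup>2 + 3 * k\<^sup>2 * d + k ^ 3" for d :: nat
    by (simp add: power3_eq_cube power2_eq_square algebra_simps)
  then have "(\<Sum>v\<in>pverts G. (vertex_degree G v + k) ^ 3) =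
      F_index G + 3 * k * M1_index G + 3 * k\<^sup>2 * (\<Sum>v\<in>pverts G. vertex_degree G v)
      + card (pverts G) * k ^ 3"
    by (simp add: F_index_def M1_index_def sum.distrib sum_distrib_left)
  then show ?thesis
    by (simp add: sum_vertex_degree)
qed

end

lemma vertex_degree_corona_Inl:
  assumes "pair_graph G1" "pair_graph G2" "v \<in> pverts G1"
  shows "vertex_degree (corona G1 G2) (Inl v) = vertex_degree G1 v + card (pverts G2)"
proof -
  interpret G1: pair_graph G1 by fact
  interpret G2: pair_graph G2 by fact
  interpret C: pair_graph "corona G1 G2" using assms by (intro pair_graph_corona)
  have "{w. (Inl v, w) \<in> parcs (corona G1 G2)} =
      Inl ` {w. (v, w) \<in> parcs G1} \<union> (\<lambda>x. Inr (v, x)) ` pverts G2"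
    using assms(3) by (auto simp: corona_def)
  moreover have "finite {w. (v, w) \<in> parcs G1}"
    by (rule finite_subset[OF _ G1.pair_finite_verts]) (auto dest: G1.wellformed')
  moreover have "Inl ` {w. (v, w) \<in> parcs G1} \<inter> (\<lambda>x. Inr (v, x)) ` pverts G2 = {}"
    by auto
  ultimately show ?thesis
    by (simp add: C.vertex_degree_eq_card_neighbours G1.vertex_degree_eq_card_neighbours
        card_Un_disjoint card_image inj_on_def)
qed

lemma vertex_degree_corona_Inr:
  assumes "pair_graph G1" "pair_graph G2" "v \<in> pverts G1" "x \<in> pverts G2"
  shows "vertex_degree (corona G1 G2) (Inr (v, x)) = vertex_degree G2 x + 1"
proof -
  interpret G2: pair_graph G2 by fact
  interpret C: pair_graph "corona G1 G2" using assms by (intro pair_graph_corona)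
  have "{w. (Inr (v, x), w) \<in> parcs (corona G1 G2)} =
      insert (Inl v) ((\<lambda>y. Inr (v, y)) ` {y. (x, y) \<in> parcs G2})"
    using assms(3,4) by (auto simp: corona_def)
  moreover have "finite {y. (x, y) \<in> parcs G2}"
    by (rule finite_subset[OF _ G2.pair_finite_verts]) (auto dest: G2.wellformed')
  ultimately show ?thesis
    by (simp add: C.vertex_degree_eq_card_neighbours G2.vertex_degree_eq_card_neighbours
        card_image inj_on_def image_iff)
qed

theorem theorem8:
  fixes G1 :: "'a pair_pre_digraph" and G2 :: "'b pair_pre_digraph"
    and n1 n2 m1 m2 :: nat
  assumes "pair_graph G1" and "connected (with_proj G1)"
    and "pair_graph G2" and "connected (with_proj G2)"
    and "n1 = card (pverts G1)" and "m1 = card (edges G1)"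
    and "n2 = card (pverts G2)" and "m2 = card (edges G2)"
  shows "F_index (corona G1 G2) =
    F_index G1 + n1 * F_index G2 + 3 * n2 * M1_index G1 + 3 * n1 * M1_index G2
    + 6 * n2\<^sup>2 * m1 + 6 * n1 * m2 + n1 * n2 * (n2\<^sup>2 + 1)"
proof -
  interpret G1: pair_graph G1 by fact
  interpret G2: pair_graph G2 by fact
  let ?d = "vertex_degree (corona G1 G2)"
  have "F_index (corona G1 G2) =
      (\<Sum>w\<in>Inl ` pverts G1. ?d w ^ 3) + (\<Sum>w\<in>Inr ` (pverts G1 \<times> pverts G2). ?d w ^ 3)"
    unfolding F_index_def by (subst sum.union_disjoint[symmetric]) (auto simp: corona_def)
  also have "\<dots> = (\<Sum>v\<in>pverts G1. ?d (Inl v) ^ 3)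
      + (\<Sum>v\<in>pverts G1. \<Sum>x\<in>pverts G2. ?d (Inr (v, x)) ^ 3)"
    by (simp add: sum.reindex sum.cartesian_product case_prod_unfold)
  also have "\<dots> = (\<Sum>v\<in>pverts G1. (vertex_degree G1 v + n2) ^ 3)
      + n1 * (\<Sum>x\<in>pverts G2. (vertex_degree G2 x + 1) ^ 3)"
    using assms by (simp add: vertex_degree_corona_Inl vertex_degree_corona_Inr)
  also have "\<dots> = F_index G1 + 3 * n2 * M1_index G1 + 6 * n2\<^sup>2 * m1 + n1 * n2 ^ 3
      + n1 * (F_index G2 + 3 * M1_index G2 + 6 * m2 + n2)"
    unfolding G1.sum_vertex_degree_plus_cubed G2.sum_vertex_degree_plus_cubed
    using assms by simp
  finally show ?thesis
    by (simp add: algebra_simps power3_eq_cube power2_eq_square)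
qed

end
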